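(* Let $G$ be a finite graph and $k \in \mathbb{N}$. Then $\sigma(G) > k$ if and only if there exists a function $\psi : V(\boxtimes^k G) \to \mathcal{P}(V(G))$ such that: (1) $\psi(T) \neq \emptyset$ for every $T \in V(\boxtimes^k G)$; (2) $\psi(T) \subseteq V(G) \setminus (A_T \cup B_T \cup C_T)$ for every $T \in V(\boxtimes^k G)$; (3) $\psi(T_1) \subseteq N_G[\psi(T_2)]$ for every edge $T_1T_2 \in E(\boxtimes^k G)$.
   Context: Surrounding Cops and Robbers on a finite simple graph $G$ with $k \geq 1$ cops and one robber: the cops first choose starting vertices (several cops may share a vertex), then the robber chooses a starting vertex not occupied by a cop, and thereafter the cops and the robber alternate moves, the cops moving first. In a move, each player may move to an adjacent vertex or stay put; the robber may never move to, or remain on, a vertex occupied by a cop, so if a cop moves onto the robber's vertex the robber is compelled to move to a neighbouring vertex not occupied by a cop. The cops win if at any time every neighbour of the robber's vertex is occupied by a cop; the robber wins if he avoids this forever. Play is with perfect information. The surrounding cop number $\sigma(G)$ is the least number of cops for which the cops have a winning strategy. $\boxtimes^k G = G \boxtimes \cdots \boxtimes G$ ($k$ factors) is the $k$-fold strong product: its vertices are $k$-tuples $T$ of vertices of $G$ (configurations of the $k$ cops), and distinct $T, T'$ are adjacent iff for each coordinate $i$, $T_i = T'_i$ or $T_iT'_i \in E(G)$ (i.e.\ the cops can move from one configuration to the other in a single move). For a configuration $T$: $A_T$ is the set of vertices of $G$ appearing as coordinates of $T$; $B_T$ is the set of vertices of $G$ all of whose neighbours appear as coordinates of $T$ (vertices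 currently surrounded by $T$); $C_T$ is the set of vertices of $G$ that can be surrounded by the cops in one move from $T$, i.e.\ vertices in $B_{T'}$ for some $T'$ equal or adjacent to $T$ in $\boxtimes^k G$. $\mathcal{P}(V(G))$ is the power set, and $N_G[S]$ is the closed neighbourhood of a set $S$ (vertices in $S$ or adjacent to some vertex of $S$). *)

theory Defs
  imports
    "Graph_Theory.Pair_Digraph"
    "HOL-Library.Extended_Nat"
    "HOL-Library.FuncSet"
begin

text \<open>
  A finite simple graph is a \<open>pair_graph\<close>: a finite, loop-free, symmetric digraph whose
  arcs are ordered pairs of vertices; an edge \<open>uv\<close> is represented by both \<open>(u, v)\<close> and
  \<open>(v, u)\<close>. A \<open>k\<close>-tuple of vertices is a list of length \<open>k\<close>.
\<close>

definition closed_nbhd :: "'a pair_pre_digraph \<Rightarrow> 'a set \<Rightarrow> 'a set" where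
  "closed_nbhd G S = S \<union> {v. \<exists>u \<in> S. (u, v) \<in> parcs G}"

definition strong_power :: "nat \<Rightarrow> 'a pair_pre_digraph \<Rightarrow> 'a list pair_pre_digraph" where
  "strong_power k G =
     (let V = {T. length T = k \<and> set T \<subseteq> pverts G}
      in \<lparr> pverts = V,
           parcs = {(T, T'). T \<in> V \<and> T' \<in> V \<and> T \<noteq> T' \<and>
                      (\<forall>i < k. T ! i = T' ! i \<or> (T ! i, T' ! i) \<in> parcs G)} \<rparr>)"

definition occupied :: "'a list \<Rightarrow> 'a set" where
  "occupied T = set T"

definition surrounded :: "'a pair_pre_digraph \<Rightarrow> 'a list \<Rightarrow> 'a set" where
  "surrounded G T = {v \<in> pverts G. \<forall>u. (v, u) \<in> parcs G \<longrightarrow> u \<in> occupied T}"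

definition cop_move :: "nat \<Rightarrow> 'a pair_pre_digraph \<Rightarrow> 'a list \<Rightarrow> 'a list \<Rightarrow> bool" where
  "cop_move k G T T' \<longleftrightarrow> T' = T \<or> (T, T') \<in> parcs (strong_power k G)"

definition surroundable :: "nat \<Rightarrow> 'a pair_pre_digraph \<Rightarrow> 'a list \<Rightarrow> 'a set" where
  "surroundable k G T = (\<Union>T' \<in> {T'. cop_move k G T T'}. surrounded G T')"

text \<open>
  A cop strategy maps the history of complete rounds (cop configuration, then robber
  position) to the next cop configuration; the empty history yields the initial
  configuration. Requiring a legal answer to every history, including those that cannot
  arise, is no restriction since the cops may always stay put.
\<close>

definition cop_strategy ::
    "nat \<Rightarrow> 'a pair_pre_digraph \<Rightarrow> (('a list \<times> 'a) list \<Rightarrow> 'a list) \<Rightarrow> bool" where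
  "cop_strategy k G s \<longleftrightarrow>
     s [] \<in> pverts (strong_power k G) \<and>
     (\<forall>h. h \<noteq> [] \<longrightarrow> fst (last h) \<in> pverts (strong_power k G) \<longrightarrow>
          cop_move k G (fst (last h)) (s h))"

definition follows ::
    "(('a list \<times> 'a) list \<Rightarrow> 'a list) \<Rightarrow> (nat \<Rightarrow> 'a list) \<Rightarrow> (nat \<Rightarrow> 'a) \<Rightarrow> bool" where
  "follows s c r \<longleftrightarrow> (\<forall>n. c n = s (map (\<lambda>i. (c i, r i)) [0..<n]))"

definition robber_legal ::
    "'a pair_pre_digraph \<Rightarrow> (nat \<Rightarrow> 'a list) \<Rightarrow> (nat \<Rightarrow> 'a) \<Rightarrow> bool" where
  "robber_legal G c r \<longleftrightarrow>
     r 0 \<in> pverts G - occupied (c 0) \<and>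
     (\<forall>n. r (Suc n) \<in> closed_nbhd G {r n} - occupied (c (Suc n)))"

text \<open>
  The robber at \<open>r n\<close> can be surrounded either right after his own move, by \<open>c n\<close>, or right
  after the following cop move, by \<open>c (Suc n)\<close>.
\<close>

definition robber_caught ::
    "'a pair_pre_digraph \<Rightarrow> (nat \<Rightarrow> 'a list) \<Rightarrow> (nat \<Rightarrow> 'a) \<Rightarrow> bool" where
  "robber_caught G c r \<longleftrightarrow>
     (\<exists>n. r n \<in> surrounded G (c n) \<or> r n \<in> surrounded G (c (Suc n)))"

text \<open>
  It suffices to consider infinite plays: once placed, a robber without a legal move has all
  his neighbours occupied, so he is surrounded and the cops have already won. A robber who
  has no vertex to start on (all vertices occupied) loses.
\<close>

definition cops_win :: "nat \<Rightarrow> 'a pair_pre_digraph \<Rightarrow> bool" where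
  "cops_win k G \<longleftrightarrow>
     (\<exists>s. cop_strategy k G s \<and>
          (\<forall>c r. follows s c r \<and> robber_legal G c r \<longrightarrow> robber_caught G c r))"

text \<open>
  The value is \<open>\<infinity>\<close> only for the graph without vertices, where the cops cannot be placed.
\<close>

definition surrounding_cop_number :: "'a pair_pre_digraph \<Rightarrow> enat" where
  "surrounding_cop_number G = Inf {enat k | k. 1 \<le> k \<and> cops_win k G}"

end

theory Submission
  imports Defs
begin

text \<open>
  A function \<open>\<psi>\<close> as in the theorem is a positional strategy for the robber: he stays inside
  \<open>\<psi> T\<close> for the current configuration \<open>T\<close>, where he cannot be surrounded by the next cop move,
  and (3) lets him follow every move of the cops. Since idle cops can shadow another cop, such a
  function for \<open>k\<close> cops restricts to fewer cops. Conversely, let \<open>\<psi> T\<close> be the set of those free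
  vertices from which the cops, about to move from \<open>T\<close>, cannot force a win within any bounded
  number of moves. As neighbourhoods are finite, bounds for the robber's individual answers yield a
  common bound, which gives (3); and if \<open>\<psi> T = {}\<close>, then the cops win by starting at \<open>T\<close> and
  always decreasing the number of moves needed.
\<close>

text \<open>Kept in the same shape as the body of the theorem, so that passing between the two at
  the end is mere unfolding.\<close>

definition evasion ::
    "nat \<Rightarrow> 'a pair_pre_digraph \<Rightarrow> ('a list \<Rightarrow> 'a set) \<Rightarrow> bool" where
  "evasion k G \<psi> \<longleftrightarrow>
     \<psi> \<in> pverts (strong_power k G) \<rightarrow> Pow (pverts G) \<and>
     (\<forall>T \<in> pverts (strong_power k G). \<psi> T \<noteq> {}) \<and>
     (\<forall>T \<in> pverts (strong_power k G).
        \<psi> T \<subseteq> pverts G - (occupied T \<union> surrounded G T \<union> surroundable k G T)) \<and>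
     (\<forall>T1 T2. (T1, T2) \<in> parcs (strong_power k G) \<longrightarrow> \<psi> T1 \<subseteq> closed_nbhd G (\<psi> T2))"

lemma pverts_strong_power:
  "T \<in> pverts (strong_power k G) \<longleftrightarrow> length T = k \<and> set T \<subseteq> pverts G"
  by (simp add: strong_power_def)

lemma parcs_strong_power:
  "(T, T') \<in> parcs (strong_power k G) \<longleftrightarrow>
     T \<in> pverts (strong_power k G) \<and> T' \<in> pverts (strong_power k G) \<and> T \<noteq> T' \<and>
     (\<forall>i < k. T ! i = T' ! i \<or> (T ! i, T' ! i) \<in> parcs G)"
  by (simp add: strong_power_def)

lemma cop_move_refl: "cop_move k G T T"
  by (simp add: cop_move_def)

lemma cop_move_pverts:
  assumes "cop_move k G T T'" and "T \<in> pverts (strong_power k G)"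
  shows "T' \<in> pverts (strong_power k G)"
  using assms by (auto simp: cop_move_def parcs_strong_power)

lemma surrounded_subset_surroundable: "surrounded G T \<subseteq> surroundable k G T"
  using cop_move_refl by (force simp: surroundable_def)

subsection \<open>Shadowing cops\<close>

text \<open>The \<open>m\<close> extra cops stand with the first cop and copy his moves. This needs
  a first cop, whence \<open>1 \<le> j\<close> below.\<close>

definition shadow :: "nat \<Rightarrow> 'a list \<Rightarrow> 'a list" where
  "shadow m T = T @ replicate m (T ! 0)"

lemma set_shadow:
  assumes "T \<noteq> []"
  shows "set (shadow m T) = set T"
  using assms by (auto simp: shadow_def set_replicate_conv_if)

lemma surrounded_shadow:
  assumes "T \<noteq> []"
  shows "surrounded G (shadow m T) = surrounded G T"
  using assms by (simp add: surrounded_def occupied_def set_shadow)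

lemma shadow_pverts:
  assumes "T \<in> pverts (strong_power j G)" and "1 \<le> j"
  shows "shadow m T \<in> pverts (strong_power (j + m) G)"
proof -
  have "T \<noteq> []"
    using assms by (auto simp: pverts_strong_power)
  then show ?thesis
    using assms by (simp add: pverts_strong_power set_shadow) (simp add: shadow_def)
qed

lemma shadow_parcs:
  assumes "(T, T') \<in> parcs (strong_power j G)" and "1 \<le> j"
  shows "(shadow m T, shadow m T') \<in> parcs (strong_power (j + m) G)"
proof -
  have len: "length T = j" "length T' = j"
    using assms by (auto simp: parcs_strong_power pverts_strong_power)
  have step: "T ! i = T' ! i \<or> (T ! i, T' ! i) \<in> parcs G" if "i < j" for i
    using assms that by (simp add: parcs_strong_power)
  have "shadow m T \<noteq> shadow m T'"
    using assms len by (auto simp: shadow_def parcs_strong_power)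
  \<comment> \<open>An index \<open>i \<ge> j\<close> belongs to a copy of the first cop, so his
    move, \<open>step[of 0]\<close>, justifies it.\<close>
  moreover have "shadow m T ! i = shadow m T' ! i \<or> (shadow m T ! i, shadow m T' ! i) \<in> parcs G"
    if "i < j + m" for i
    using that len step[of i] step[of 0] assms(2) by (auto simp: shadow_def nth_append)
  moreover have "T \<in> pverts (strong_power j G)" "T' \<in> pverts (strong_power j G)"
    using assms by (auto simp: parcs_strong_power)
  ultimately show ?thesis
    using shadow_pverts assms(2) by (auto simp: parcs_strong_power)
qed

text \<open>A move of the \<open>j\<close> cops lifts to a move of all cops that occupies the same
  vertices. Inclusion is enough: a robber who avoids the larger set avoids the smaller one.\<close>

lemma surroundable_shadow:
  assumes "T \<in> pverts (strong_power j G)" and "1 \<le> j"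
  shows "surroundable j G T \<subseteq> surroundable (j + m) G (shadow m T)"
proof
  fix v assume "v \<in> surroundable j G T"
  then obtain T' where T': "cop_move j G T T'" "v \<in> surrounded G T'"
    by (auto simp: surroundable_def)
  then have "T' \<noteq> []"
    using cop_move_pverts[OF T'(1) assms(1)] assms(2) by (auto simp: pverts_strong_power)
  then have "v \<in> surrounded G (shadow m T')"
    using T'(2) by (simp add: surrounded_shadow)
  moreover have "cop_move (j + m) G (shadow m T) (shadow m T')"
    using T'(1) shadow_parcs[OF _ assms(2)] by (auto simp: cop_move_def)
  ultimately show "v \<in> surroundable (j + m) G (shadow m T)"
    by (auto simp: surroundable_def)
qed

text \<open>\<open>\<psi>\<close> speaks of exactly \<open>k\<close> cops, while a surrounding cop
  number above \<open>k\<close> also excludes wins with fewer; this lemma bridges the gap.\<close>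

lemma evasion_fewer_cops:
  assumes "evasion (j + m) G \<psi>" and "1 \<le> j"
  shows "evasion j G (\<psi> \<circ> shadow m)"
proof -
  have ne: "T \<noteq> []" if "T \<in> pverts (strong_power j G)" for T
    using that assms(2) by (auto simp: pverts_strong_power)
  have sub: "\<psi> (shadow m T) \<subseteq>
      pverts G - (occupied T \<union> surrounded G T \<union> surroundable j G T)"
    if T: "T \<in> pverts (strong_power j G)" for T
  proof -
    have "\<psi> (shadow m T) \<subseteq> pverts G - (occupied (shadow m T) \<union>
        surrounded G (shadow m T) \<union> surroundable (j + m) G (shadow m T))"
      using assms(1) shadow_pverts[OF T assms(2)] by (simp add: evasion_def)
    then show ?thesis
      using surroundable_shadow[OF T assms(2), of m] ne[OF T]
      by (auto simp: occupied_def set_shadow surrounded_shadow)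
  qed
  moreover have "\<psi> (shadow m T) \<noteq> {}" if "T \<in> pverts (strong_power j G)" for T
    using assms(1) shadow_pverts[OF that assms(2)] by (simp add: evasion_def)
  moreover have "\<psi> (shadow m T1) \<subseteq> closed_nbhd G (\<psi> (shadow m T2))"
    if "(T1, T2) \<in> parcs (strong_power j G)" for T1 T2
    using assms(1) shadow_parcs[OF that assms(2)] by (simp add: evasion_def)
  moreover have "\<psi> \<circ> shadow m \<in> pverts (strong_power j G) \<rightarrow> Pow (pverts G)"
    using sub by fastforce
  ultimately show ?thesis
    by (simp add: evasion_def)
qed

subsection \<open>Evading the cops\<close>

text \<open>If the cops stay put, so does the robber. Otherwise condition (3) puts \<open>v\<close>
  in \<open>\<psi> T'\<close> or gives it a neighbour there, and symmetry of the arcs turns that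
  into a robber move from \<open>v\<close>.\<close>

lemma evasion_follow:
  assumes "pair_graph G" and "evasion k G \<psi>" and "cop_move k G T T'" and "v \<in> \<psi> T"
  shows "\<exists>v' \<in> \<psi> T'. v' \<in> closed_nbhd G {v}"
proof -
  interpret pair_graph G by (fact assms(1))
  show ?thesis
  proof (cases "T' = T")
    case True
    then show ?thesis
      using assms(4) by (auto simp: closed_nbhd_def)
  next
    case False
    then have "v \<in> closed_nbhd G (\<psi> T')"
      using assms unfolding cop_move_def evasion_def by blast
    moreover have "(v, u) \<in> parcs G" if "(u, v) \<in> parcs G" for u
      using that by (rule arcs_symmetric)
    ultimately show ?thesis
      by (auto simp: closed_nbhd_def)
  qed
qed

lemma evasion_not_cops_win:
  assumes "pair_graph G" and ev: "evasion k G \<psi>"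
  shows "\<not> cops_win k G"
proof
  assume "cops_win k G"
  then obtain s where s: "cop_strategy k G s"
    and win: "\<And>c r. follows s c r \<Longrightarrow> robber_legal G c r \<Longrightarrow> robber_caught G c r"
    by (auto simp: cops_win_def)
  have start: "s [] \<in> pverts (strong_power k G)"
    using s by (simp add: cop_strategy_def)
  have move: "cop_move k G (fst (last h)) (s h)"
    if "h \<noteq> []" "fst (last h) \<in> pverts (strong_power k G)" for h
    using s that by (simp add: cop_strategy_def)
  define next_pos where "next_pos T v = (SOME v'. v' \<in> \<psi> T \<and> v' \<in> closed_nbhd G {v})" for T v
  have next_pos: "next_pos T' v \<in> \<psi> T' \<and> next_pos T' v \<in> closed_nbhd G {v}"
    if "cop_move k G T T'" "v \<in> \<psi> T" for T T' v
    unfolding next_pos_def using evasion_follow[OF assms that] by (metis (mono_tags, lifting) someI)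
  \<comment> \<open>The cop strategy may depend on the whole past, so the recursion builds
    histories. \<open>hist n\<close> consists of rounds 0 to \<open>n\<close> and is therefore the
    argument from which \<open>s\<close> computes \<open>c (Suc n)\<close>.\<close>
  define hist where
    "hist = rec_nat [(s [], SOME v. v \<in> \<psi> (s []))]
       (\<lambda>_ h. h @ [(s h, next_pos (s h) (snd (last h)))])"
  have hist_0: "hist 0 = [(s [], SOME v. v \<in> \<psi> (s []))]"
    and hist_Suc: "hist (Suc n) = hist n @ [(s (hist n), next_pos (s (hist n)) (snd (last (hist n))))]"
    for n by (simp_all add: hist_def)
  define c where "c n = fst (last (hist n))" for n
  define r where "r n = snd (last (hist n))" for n
  have hist_nonempty: "hist n \<noteq> []" for n
    by (cases n) (simp_all add: hist_0 hist_Suc)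
  have hist_eq: "hist n = map (\<lambda>i. (c i, r i)) [0..<Suc n]" for n
    by (induction n) (simp_all add: hist_0 hist_Suc c_def r_def)
  have c_0: "c 0 = s []" and c_Suc: "c (Suc n) = s (hist n)" for n
    by (simp_all add: c_def hist_0 hist_Suc)
  have r_Suc: "r (Suc n) = next_pos (c (Suc n)) (r n)" for n
    by (simp add: r_def c_def hist_Suc)
  have inv: "c n \<in> pverts (strong_power k G) \<and> r n \<in> \<psi> (c n)" for n
  proof (induction n)
    case 0
    have "\<exists>v. v \<in> \<psi> (s [])"
      using ev start by (auto simp: evasion_def)
    then show ?case
      using start someI_ex[of "\<lambda>v. v \<in> \<psi> (s [])"] by (simp add: c_0 r_def hist_0)
  next
    case (Suc n)
    then have "cop_move k G (c n) (c (Suc n))"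
      using move[OF hist_nonempty, of n] by (simp add: c_Suc) (simp add: c_def)
    then show ?case
      using Suc next_pos cop_move_pverts by (metis r_Suc)
  qed
  have c_move: "cop_move k G (c n) (c (Suc n))" for n
    using move[OF hist_nonempty, of n] inv[of n] by (simp add: c_Suc) (simp add: c_def)
  have safe: "r n \<in> pverts G - (occupied (c n) \<union> surrounded G (c n) \<union> surroundable k G (c n))" for n
    using inv[of n] ev by (auto simp: evasion_def)
  have "follows s c r"
    unfolding follows_def
  proof
    fix n
    show "c n = s (map (\<lambda>i. (c i, r i)) [0..<n])"
      using hist_eq c_Suc by (cases n) (simp_all add: c_0)
  qed
  moreover have "robber_legal G c r"
    unfolding robber_legal_def using safe next_pos[OF c_move] inv r_Suc by (metis Diff_iff UnCI)
  ultimately have "robber_caught G c r"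
    by (rule win)
  \<comment> \<open>This excludes the second way of being caught, by the cop move that follows;
    \<open>safe\<close> alone excludes the first.\<close>
  moreover have "surrounded G (c (Suc n)) \<subseteq> surroundable k G (c n)" for n
    using c_move by (auto simp: surroundable_def)
  ultimately show False
    using safe by (fastforce simp: robber_caught_def)
qed

subsection \<open>Bounded wins of the cops\<close>

text \<open>The cops are to move and \<open>n\<close> bounds the number of their moves. A robber
  already surrounded by \<open>T\<close> needs no clause of his own, since the cops may stay put;
  one without a legal answer makes the inner quantifier vacuous.\<close>

fun wins_within ::
    "nat \<Rightarrow> 'a pair_pre_digraph \<Rightarrow> nat \<Rightarrow> 'a list \<Rightarrow> 'a \<Rightarrow> bool" where
  "wins_within k G 0 T v \<longleftrightarrow> False"
| "wins_within k G (Suc n) T v \<longleftrightarrow>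
     (\<exists>T'. cop_move k G T T' \<and>
        (v \<in> surrounded G T' \<or>
         (\<forall>v' \<in> closed_nbhd G {v} - occupied T'. wins_within k G n T' v')))"

lemma wins_within_mono:
  assumes "wins_within k G m T v" and "m \<le> n"
  shows "wins_within k G n T v"
proof -
  have step: "wins_within k G n T v \<Longrightarrow> wins_within k G (Suc n) T v" for n
  proof (induction n arbitrary: T v)
    case (Suc n)
    then show ?case
      by (metis wins_within.simps(2))
  qed simp
  show ?thesis
    using assms(2,1) by (induction rule: dec_induct) (use step in \<open>blast+\<close>)
qed

text \<open>By monotonicity the maximum of finitely many individual bounds serves every vertex; so
  natural numbers suffice to measure the progress of the cops.\<close>

lemma wins_within_uniform:
  assumes "finite S" and "\<And>v. v \<in> S \<Longrightarrow> \<exists>n. wins_within k G n T v"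
  shows "\<exists>n. \<forall>v \<in> S. wins_within k G n T v"
proof -
  obtain f where f: "\<And>v. v \<in> S \<Longrightarrow> wins_within k G (f v) T v"
    using assms(2) by metis
  have "wins_within k G (Max (f ` S)) T v" if "v \<in> S" for v
    using wins_within_mono[OF f[OF that]] assms(1) that by simp
  then show ?thesis
    by blast
qed

text \<open>A move that is optimal for the least bound serves every larger bound too. Hence the
  answer can be chosen from \<open>T\<close> and \<open>v\<close> alone, without knowing
  \<open>n\<close>; in a position with no bounded win, staying put is a legal default.\<close>

lemma wins_within_response:
  "\<exists>T'. cop_move k G T T' \<and>
     (\<forall>n. wins_within k G n T v \<longrightarrow> v \<in> surrounded G T' \<or>
        (\<exists>m < n. \<forall>v' \<in> closed_nbhd G {v} - occupied T'. wins_within k G m T' v'))"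
proof (cases "\<exists>n. wins_within k G n T v")
  case True
  define l where "l = (LEAST n. wins_within k G n T v)"
  have l: "wins_within k G l T v" and least: "\<And>n. wins_within k G n T v \<Longrightarrow> l \<le> n"
    using True by (auto simp: l_def intro: LeastI_ex Least_le)
  then obtain m where m: "l = Suc m"
    by (cases l) auto
  then obtain T' where "cop_move k G T T'" and "v \<in> surrounded G T' \<or>
      (\<forall>v' \<in> closed_nbhd G {v} - occupied T'. wins_within k G m T' v')"
    using l by auto
  then show ?thesis
    using least m by (metis Suc_le_lessD)
next
  case False
  then show ?thesis
    using cop_move_refl by blast
qed

lemma wins_within_cops_win:
  assumes T: "T \<in> pverts (strong_power k G)"
    and wins: "\<And>v. v \<in> pverts G - occupied T \<Longrightarrow> \<exists>n. wins_within k G n T v"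
  shows "cops_win k G"
proof -
  define f where "f T v = (SOME T'. cop_move k G T T' \<and>
     (\<forall>n. wins_within k G n T v \<longrightarrow> v \<in> surrounded G T' \<or>
        (\<exists>m < n. \<forall>v' \<in> closed_nbhd G {v} - occupied T'. wins_within k G m T' v')))" for T v
  note f = someI_ex[OF wins_within_response[of k G], folded f_def]
  have f_move: "cop_move k G T (f T v)" for T v
    using f[of T v] by (rule conjunct1)
  have f_wins: "v \<in> surrounded G (f T v) \<or>
      (\<exists>m < n. \<forall>v' \<in> closed_nbhd G {v} - occupied (f T v). wins_within k G m (f T v) v')"
    if "wins_within k G n T v" for T v n
    using f[of T v] that by simp
  \<comment> \<open>The strategy is positional: it reads only the last round of the history.\<close>
  define s where "s h = (if h = [] then T else f (fst (last h)) (snd (last h)))" for h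
  have "cop_strategy k G s"
    using T f_move by (simp add: cop_strategy_def s_def)
  moreover have "robber_caught G c r" if "follows s c r" and legal: "robber_legal G c r" for c r
  proof -
    have c: "c n = s (map (\<lambda>i. (c i, r i)) [0..<n])" for n
      using that(1) unfolding follows_def by blast
    have c_0: "c 0 = T"
      using c[of 0] by (simp add: s_def)
    have c_Suc: "c (Suc i) = f (c i) (r i)" for i
      using c[of "Suc i"] by (simp add: s_def)
    \<comment> \<open>The bound may drop by more than one per round, because \<open>f\<close> aims
      at the least bound; hence strong induction.\<close>
    have caught: "wins_within k G n (c i) (r i) \<Longrightarrow> robber_caught G c r" for n i
    proof (induction n arbitrary: i rule: less_induct)
      case (less n)
      have "r (Suc i) \<in> closed_nbhd G {r i} - occupied (c (Suc i))"
        using legal by (simp add: robber_legal_def)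
      then have "r i \<in> surrounded G (c (Suc i)) \<or>
          (\<exists>m < n. wins_within k G m (c (Suc i)) (r (Suc i)))"
        using f_wins[OF less.prems] by (auto simp: c_Suc)
      then show ?case
        using less.IH by (auto simp: robber_caught_def)
    qed
    have "r 0 \<in> pverts G - occupied T"
      using legal by (simp add: robber_legal_def c_0)
    then show ?thesis
      using wins caught[of _ 0] by (auto simp: c_0)
  qed
  ultimately show ?thesis
    by (auto simp: cops_win_def)
qed

lemma not_cops_win_evasion:
  assumes "pair_graph G" and "\<not> cops_win k G"
  shows "\<exists>\<psi>. evasion k G \<psi>"
proof -
  interpret pair_graph G by (fact assms(1))
  define \<psi> where "\<psi> T = {v \<in> pverts G - occupied T. \<forall>n. \<not> wins_within k G n T v}" for T
  have "\<psi> T \<noteq> {}" if "T \<in> pverts (strong_power k G)" for T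
    using wins_within_cops_win[OF that] assms(2) by (auto simp: \<psi>_def)
  moreover have "v \<notin> surroundable k G T" if "v \<in> \<psi> T" for T v
  proof
    assume "v \<in> surroundable k G T"
    \<comment> \<open>A vertex that can be surrounded in one move is a win within one move, so it is
      not in \<open>\<psi> T\<close>.\<close>
    then have "wins_within k G (Suc 0) T v"
      by (auto simp: surroundable_def)
    then show False
      using that by (auto simp: \<psi>_def simp del: wins_within.simps)
  qed
  then have "\<psi> T \<subseteq> pverts G - (occupied T \<union> surrounded G T \<union> surroundable k G T)" for T
    using surrounded_subset_surroundable[of G T k] by (auto simp: \<psi>_def)
  moreover have "v \<in> closed_nbhd G (\<psi> T2)"
    if arc: "(T1, T2) \<in> parcs (strong_power k G)" and v: "v \<in> \<psi> T1" for T1 T2 v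
  proof -
    let ?S = "closed_nbhd G {v} - occupied T2"
    have S: "?S \<subseteq> pverts G"
      using v by (auto simp: closed_nbhd_def \<psi>_def dest: in_arcsD2)
    have "\<not> (\<forall>v' \<in> ?S. wins_within k G n T2 v')" for n
    proof
      assume "\<forall>v' \<in> ?S. wins_within k G n T2 v'"
      then have "wins_within k G (Suc n) T1 v"
        using arc by (auto simp: cop_move_def)
      then show False
        using v by (auto simp: \<psi>_def simp del: wins_within.simps)
    qed
    \<comment> \<open>So far each bound \<open>n\<close> has its own answer that survives it.
      Finiteness of \<open>?S\<close> yields a single answer that survives all bounds, for otherwise
      \<open>wins_within_uniform\<close> would give a common losing bound.\<close>
    then obtain v' where "v' \<in> ?S" "\<forall>n. \<not> wins_within k G n T2 v'"
      using wins_within_uniform finite_subset[OF S pair_finite_verts] by metis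
    then have "v' \<in> \<psi> T2" and "v' \<in> closed_nbhd G {v}"
      using S by (auto simp: \<psi>_def)
    then show ?thesis
      using arcs_symmetric by (auto simp: closed_nbhd_def)
  qed
  ultimately have "evasion k G \<psi>"
    by (auto simp: evasion_def \<psi>_def)
  then show ?thesis
    by blast
qed

section \<open>From the infimum to the individual numbers of cops\<close>

lemma surrounding_cop_number_gt_iff:
  "surrounding_cop_number G > enat k \<longleftrightarrow> (\<forall>j. 1 \<le> j \<and> j \<le> k \<longrightarrow> \<not> cops_win j G)"
proof
  assume less: "surrounding_cop_number G > enat k"
  show "\<forall>j. 1 \<le> j \<and> j \<le> k \<longrightarrow> \<not> cops_win j G"
  proof (intro allI impI notI)
    fix j assume "1 \<le> j \<and> j \<le> k" and "cops_win j G"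
    then have "surrounding_cop_number G \<le> enat j"
      unfolding surrounding_cop_number_def by (intro Inf_lower) auto
    also have "\<dots> \<le> enat k"
      using \<open>1 \<le> j \<and> j \<le> k\<close> by simp
    finally show False
      using less by simp
  qed
next
  assume "\<forall>j. 1 \<le> j \<and> j \<le> k \<longrightarrow> \<not> cops_win j G"
  \<comment> \<open>Every winning number of cops is at least \<open>Suc k\<close>; this also covers
    the empty set, whose infimum is infinite.\<close>
  then have "enat (Suc k) \<le> surrounding_cop_number G"
    unfolding surrounding_cop_number_def
    by (intro Inf_greatest) (auto simp: not_less_eq_eq[symmetric])
  then show "surrounding_cop_number G > enat k"
    by (simp add: Suc_ile_eq)
qed

theorem theorem12:
  fixes G :: "'a pair_pre_digraph" and k :: nat
  assumes "pair_graph G" and "k \<ge> 1"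
  shows "surrounding_cop_number G > enat k \<longleftrightarrow>
    (\<exists>\<psi> \<in> pverts (strong_power k G) \<rightarrow> Pow (pverts G).
       (\<forall>T \<in> pverts (strong_power k G). \<psi> T \<noteq> {}) \<and>
       (\<forall>T \<in> pverts (strong_power k G).
          \<psi> T \<subseteq> pverts G - (occupied T \<union> surrounded G T \<union> surroundable k G T)) \<and>
       (\<forall>T1 T2. (T1, T2) \<in> parcs (strong_power k G) \<longrightarrow>
          \<psi> T1 \<subseteq> closed_nbhd G (\<psi> T2)))"
proof -
  have "surrounding_cop_number G > enat k \<longleftrightarrow> (\<exists>\<psi>. evasion k G \<psi>)"
  proof
    assume "surrounding_cop_number G > enat k"
    then show "\<exists>\<psi>. evasion k G \<psi>"
      using not_cops_win_evasion[OF assms(1)] assms(2) by (simp add: surrounding_cop_number_gt_iff)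
  next
    assume "\<exists>\<psi>. evasion k G \<psi>"
    then obtain \<psi> where \<psi>: "evasion k G \<psi>" ..
    have "\<not> cops_win j G" if "1 \<le> j" "j \<le> k" for j
      \<comment> \<open>The \<open>k\<close> cops are \<open>j\<close> genuine ones and
        \<open>k - j\<close> shadows.\<close>
      using evasion_fewer_cops[of j "k - j" G \<psi>] \<psi> that evasion_not_cops_win[OF assms(1)] by auto
    then show "surrounding_cop_number G > enat k"
      by (simp add: surrounding_cop_number_gt_iff)
  qed
  then show ?thesis
    by (simp only: evasion_def Bex_def)
qed

end
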